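(* Let $f=\phi\circ T$ on (a neighborhood of) $\mathrm{St}(k,n)$, where $$T(P)=\begin{bmatrix} f_1(P_1)\\ \vdots\\ f_N(P_N)\end{bmatrix}\in\mathfrak{D}\subseteq\mathbb{R}^N,$$ each $P_i\in\mathbb{R}^{n\times k_i}$ being a submatrix of $P$ consisting of a few or all columns of $P$ (different $P_i$ may share columns), and $\phi:\mathfrak{D}\to\mathbb{R}$ is convex and differentiable with partial derivatives $\phi_i(x)=\partial\phi(x)/\partial x_i$. Suppose there are a subset $\mathbb{P}\subseteq\mathrm{St}(k,n)$ and constants $\alpha>0$, $\beta_i\ge0$, $\gamma_i=\alpha+\beta_i$ ($1\le i\le N$) such that, for $1\le i\le N$, (A) $\mathrm{tr}\big(P_i^{\mathrm T}\frac{\partial f_i(P_i)}{\partial P_i}\big)=\gamma_i f_i(P_i)$ for all $P\in\mathbb{P}$; (B) given $P\in\mathbb{P}$ and $\widehat P\in\mathrm{St}(k,n)$, there exists $Q\in\mathrm{St}(k,k)$ (the same $Q$ for all $i$) such that $\widetilde P=\widehat PQ\in\mathbb{P}$ and $$\mathrm{tr}\Big(\widehat P_i^{\mathrm T}\frac{\partial f_i(P_i)}{\partial P_i}\Big)\le\alpha f_i(\widetilde P_i)+\beta_i f_i(P_i),$$ where $\widehat P_i$ and $\widetilde P_i$ are the submatrices of $\widehat P$ and $\widetilde P$ with the same column indices as $P_i$ in $P$. If $\phi_i(x)\ge0$ (for all $x\in\mathfrak{D}$) for those $i$ for which the inequality in (B) does not become an equality, then the NPDo Ansatz holds for $f$ (with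 $\mathbb{P}$) with $\omega=1/\alpha$.
   Context: $1\le k\le n$; $\mathrm{St}(k,n)=\{P\in\mathbb{R}^{n\times k}: P^{\mathrm T}P=I_k\}$; $\mathfrak{D}$ is a convex domain in $\mathbb{R}^N$; $f$ and the $f_i$ are differentiable, and $\partial f(P)/\partial P$ (similarly $\partial f_i(P_i)/\partial P_i\in\mathbb{R}^{n\times k_i}$) is the matrix of partial derivatives with all entries of the matrix variable treated as independent. Writing $P_i=PJ_i$ with $J_i$ the corresponding column-selecting submatrix of $I_k$, one has $\mathcal{H}(P):=\frac{\partial f(P)}{\partial P}=\sum_{i=1}^N\phi_i(T(P))\frac{\partial f_i(P_i)}{\partial P_i}J_i^{\mathrm T}$. "The inequality in (B) becomes an equality for $i$" means that it holds with equality for index $i$ for all $P\in\mathbb{P}$, $\widehat P\in\mathrm{St}(k,n)$ and the corresponding $Q$ (as happens e.g. for $f_i(P_i)=\mathrm{tr}(P_i^{\mathrm T}D_i)$ with $\mathbb{P}=\mathrm{St}(k,n)$, $Q=I_k$). NPDo Ansatz with constant $\omega>0$ (for $f$ with $\mathbb{P}$): whenever $P\in\mathbb{P}$, $\widehat P\in\mathrm{St}(k,n)$ and $\eta\in\mathbb{R}$ satisfy $\mathrm{tr}(\widehat P^{\mathrm T}\mathcal{H}(P))\ge \mathrm{tr}(P^{\mathrm T}\mathcal{H}(P))+\eta$, there exists $Q\in\mathrm{St}(k,k)$ such that $\widetilde P=\widehat PQ\in\mathbb{P}$ and $f(\widetilde P)\ge f(P)+\omega\eta$. *)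

theory Defs
  imports "HOL-Analysis.Analysis" "Jordan_Normal_Form.DL_Submatrix"
begin

(* The submatrices P_i have a number of columns that varies with i, so matrices are
   Jordan_Normal_Form matrices with explicit carriers. *)

definition stiefel :: "nat \<Rightarrow> nat \<Rightarrow> real mat set" where
  "stiefel k n = {P \<in> carrier_mat n k. transpose_mat P * P = 1\<^sub>m k}"

definition mtrace :: "real mat \<Rightarrow> real" where
  "mtrace A = (\<Sum>i<dim_row A. A $$ (i, i))"

definition frob_norm :: "real mat \<Rightarrow> real" where
  "frob_norm A = sqrt (\<Sum>i<dim_row A. \<Sum>j<dim_col A. (A $$ (i, j))\<^sup>2)"

definition mat_open :: "nat \<Rightarrow> nat \<Rightarrow> real mat set \<Rightarrow> bool" where
  "mat_open n k U \<longleftrightarrow> U \<subseteq> carrier_mat n k \<and>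
     (\<forall>X\<in>U. \<exists>e>0. \<forall>Y\<in>carrier_mat n k. frob_norm (Y - X) < e \<longrightarrow> Y \<in> U)"

(* Frechet differentiability at X in the space of real matrices of the same shape as X;
   every linear functional on that space has the form Z \<mapsto> tr (G^T Z). *)
definition mat_differentiable :: "(real mat \<Rightarrow> real) \<Rightarrow> real mat \<Rightarrow> bool" where
  "mat_differentiable f X \<longleftrightarrow>
     (\<exists>G\<in>carrier_mat (dim_row X) (dim_col X). \<forall>e>0. \<exists>d>0.
        \<forall>Y\<in>carrier_mat (dim_row X) (dim_col X). frob_norm (Y - X) < d \<longrightarrow>
          \<bar>f Y - f X - mtrace (transpose_mat G * (Y - X))\<bar> \<le> e * frob_norm (Y - X))"

(* The matrix of partial derivatives of f at X, all entries treated as independent variables. *)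
definition mat_grad :: "(real mat \<Rightarrow> real) \<Rightarrow> real mat \<Rightarrow> real mat" where
  "mat_grad f X = mat (dim_row X) (dim_col X)
     (\<lambda>(i, j). deriv (\<lambda>t. f (X |\<^sub>m (i, j) \<mapsto> t)) (X $$ (i, j)))"

definition partial_deriv :: "(real ^ 'N \<Rightarrow> real) \<Rightarrow> 'N::finite \<Rightarrow> real ^ 'N \<Rightarrow> real" where
  "partial_deriv \<phi> i x = deriv (\<lambda>t. \<phi> (x + t *\<^sub>R axis i 1)) 0"

(* Columns are numbered from 0. *)
definition col_submatrix :: "real mat \<Rightarrow> nat set \<Rightarrow> real mat" where
  "col_submatrix P J = submatrix P UNIV J"

definition stack :: "('N \<Rightarrow> real mat \<Rightarrow> real) \<Rightarrow> ('N \<Rightarrow> nat set) \<Rightarrow> real mat \<Rightarrow> real ^ 'N::finite" where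
  "stack fs J P = (\<chi> i. fs i (col_submatrix P (J i)))"

definition NPDo_ansatz ::
  "nat \<Rightarrow> nat \<Rightarrow> (real mat \<Rightarrow> real) \<Rightarrow> real mat set \<Rightarrow> real \<Rightarrow> bool" where
  "NPDo_ansatz k n f \<P> \<omega> \<longleftrightarrow> \<omega> > 0 \<and>
     (\<forall>P\<in>\<P>. \<forall>P'\<in>stiefel k n. \<forall>\<eta>.
        mtrace (transpose_mat P' * mat_grad f P) \<ge> mtrace (transpose_mat P * mat_grad f P) + \<eta> \<longrightarrow>
        (\<exists>Q\<in>stiefel k k. P' * Q \<in> \<P> \<and> f (P' * Q) \<ge> f P + \<omega> * \<eta>))"

end

theory Submission
  imports Defs
begin

text \<open>By the chain rule, \<open>tr (P'\<^sup>T H(P))\<close> is the sum of the \<open>tr (P'\<^sub>i\<^sup>T G\<^sub>i)\<close> weighted by the partial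
  derivatives of \<open>\<phi>\<close> at \<open>T(P)\<close>, where \<open>G\<^sub>i\<close> is the gradient of \<open>f\<^sub>i\<close> at \<open>P\<^sub>i\<close>. Applied to \<open>P\<close> and to \<open>P'\<close>, (A)
  and (B) turn the hypothesis on \<open>\<eta>\<close> into \<open>\<eta> \<le> \<alpha> \<nabla>\<phi>(T(P)) \<bullet> (T(P' Q) - T(P))\<close>, and by the gradient inequality for
  the convex \<open>\<phi>\<close> this is at most \<open>\<alpha> (f(P' Q) - f(P))\<close>.\<close>

section \<open>Traces as entrywise inner products, and perturbations of a single entry\<close>

lemma mtrace_transpose_mult:
  assumes "A \<in> carrier_mat n k" "B \<in> carrier_mat n k"
  shows "mtrace (transpose_mat A * B) = (\<Sum>c<k. \<Sum>r<n. A $$ (r, c) * B $$ (r, c))"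
  using assms unfolding mtrace_def
  by (auto simp: scalar_prod_def atLeast0LessThan intro!: sum.cong)

lemma sum_single_entry:
  fixes g :: "nat \<Rightarrow> nat \<Rightarrow> 'a::comm_monoid_add"
  assumes "r < n" "c < k"
  shows "(\<Sum>j<k. \<Sum>i<n. if (i, j) = (r, c) then g i j else 0) = g r c"
proof -
  have "(\<Sum>i<n. if (i, j) = (r, c) then g i j else 0) = (if j = c then g r c else 0)" for j
    using assms by (cases "j = c") auto
  then show ?thesis using assms by simp
qed

lemma update_mat_carrier: "X \<in> carrier_mat n k \<Longrightarrow> (X |\<^sub>m rc \<mapsto> t) \<in> carrier_mat n k"
  by (auto simp: update_mat_def)

lemma update_mat_self: "(X |\<^sub>m rc \<mapsto> X $$ rc) = X"
  by (rule eq_matI) (auto simp: update_mat_def)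

lemma index_update_mat:
  assumes "X \<in> carrier_mat n k" "i < n" "j < k"
  shows "(X |\<^sub>m rc \<mapsto> t) $$ (i, j) = (if (i, j) = rc then t else X $$ (i, j))"
  using assms by (auto simp: update_mat_def)

lemma update_mat_minus:
  fixes X :: "real mat"
  assumes "X \<in> carrier_mat n k" "i < n" "j < k"
  shows "((X |\<^sub>m rc \<mapsto> t) - X) $$ (i, j) = (if (i, j) = rc then t - X $$ rc else 0)"
  using assms by (auto simp: update_mat_def)

lemma frob_norm_update_minus:
  assumes "X \<in> carrier_mat n k" "r < n" "c < k"
  shows "frob_norm ((X |\<^sub>m (r, c) \<mapsto> t) - X) = \<bar>t - X $$ (r, c)\<bar>"
proof -
  let ?E = "(X |\<^sub>m (r, c) \<mapsto> t) - X"
  have "(\<Sum>i<dim_row ?E. \<Sum>j<dim_col ?E. (?E $$ (i, j))\<^sup>2)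
      = (\<Sum>i<n. \<Sum>j<k. if (j, i) = (c, r) then (t - X $$ (r, c))\<^sup>2 else 0)"
    using assms update_mat_minus[OF assms(1)] by (auto intro!: sum.cong)
  also have "\<dots> = (t - X $$ (r, c))\<^sup>2"
    using sum_single_entry[of c k r n "\<lambda>_ _. (t - X $$ (r, c))\<^sup>2"] assms by blast
  finally show ?thesis unfolding frob_norm_def by simp
qed

lemma mtrace_transpose_mult_update_minus:
  assumes "X \<in> carrier_mat n k" "G \<in> carrier_mat n k" "r < n" "c < k"
  shows "mtrace (transpose_mat G * ((X |\<^sub>m (r, c) \<mapsto> t) - X)) = G $$ (r, c) * (t - X $$ (r, c))"
proof -
  have "(X |\<^sub>m (r, c) \<mapsto> t) - X \<in> carrier_mat n k"
    using assms(1) by (auto simp: update_mat_def)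
  then have "mtrace (transpose_mat G * ((X |\<^sub>m (r, c) \<mapsto> t) - X))
      = (\<Sum>j<k. \<Sum>i<n. G $$ (i, j) * ((X |\<^sub>m (r, c) \<mapsto> t) - X) $$ (i, j))"
    by (rule mtrace_transpose_mult[OF assms(2)])
  also have "\<dots> = (\<Sum>j<k. \<Sum>i<n. if (i, j) = (r, c) then G $$ (i, j) * (t - X $$ (r, c)) else 0)"
    using update_mat_minus[OF assms(1)] by (auto intro!: sum.cong)
  also have "\<dots> = G $$ (r, c) * (t - X $$ (r, c))"
    by (rule sum_single_entry[OF assms(3,4)])
  finally show ?thesis .
qed

section \<open>Partial derivatives of functions of a matrix\<close>

lemma mat_grad_carrier: "X \<in> carrier_mat n k \<Longrightarrow> mat_grad f X \<in> carrier_mat n k"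
  by (auto simp: mat_grad_def)

text \<open>Along the matrices that differ from \<open>X\<close> in one entry, both the Frobenius
  norm and the trace functional reduce to expressions in that entry, so the Frechet condition
  becomes differentiability in one variable. This guarantees that the \<open>deriv\<close> in
  \<open>mat_grad\<close> is a genuine derivative and not an arbitrary value.\<close>

lemma mat_differentiable_has_real_derivative:
  assumes diff: "mat_differentiable f X" and X: "X \<in> carrier_mat n k" and rc: "r < n" "c < k"
  shows "((\<lambda>t. f (X |\<^sub>m (r, c) \<mapsto> t)) has_real_derivative mat_grad f X $$ (r, c)) (at (X $$ (r, c)))"
proof -
  let ?x = "X $$ (r, c)"
  obtain G where G: "G \<in> carrier_mat n k"
    and appr: "\<And>e. e > 0 \<Longrightarrow> \<exists>d>0. \<forall>Y\<in>carrier_mat n k. frob_norm (Y - X) < d \<longrightarrow>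
          \<bar>f Y - f X - mtrace (transpose_mat G * (Y - X))\<bar> \<le> e * frob_norm (Y - X)"
    using diff carrier_matD[OF X] unfolding mat_differentiable_def by metis
  have "((\<lambda>t. f (X |\<^sub>m (r, c) \<mapsto> t)) has_derivative (\<lambda>h. G $$ (r, c) * h)) (at ?x)"
    unfolding has_derivative_at_alt
  proof (intro conjI allI impI bounded_linear_mult_right)
    fix e :: real assume "e > 0"
    then obtain d where "d > 0" and d: "\<forall>Y\<in>carrier_mat n k. frob_norm (Y - X) < d \<longrightarrow>
          \<bar>f Y - f X - mtrace (transpose_mat G * (Y - X))\<bar> \<le> e * frob_norm (Y - X)"
      using appr by blast
    have "norm (f (X |\<^sub>m (r, c) \<mapsto> t) - f (X |\<^sub>m (r, c) \<mapsto> ?x) - G $$ (r, c) * (t - ?x)) \<le> e * norm (t - ?x)"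
      if "norm (t - ?x) < d" for t
    proof -
      have "(X |\<^sub>m (r, c) \<mapsto> t) \<in> carrier_mat n k"
        using X by (rule update_mat_carrier)
      from d[rule_format, OF this] that show ?thesis
        by (simp add: frob_norm_update_minus[OF X rc] mtrace_transpose_mult_update_minus[OF X G rc] update_mat_self)
    qed
    with \<open>d > 0\<close> show "\<exists>d>0. \<forall>t. norm (t - ?x) < d \<longrightarrow>
        norm (f (X |\<^sub>m (r, c) \<mapsto> t) - f (X |\<^sub>m (r, c) \<mapsto> ?x) - G $$ (r, c) * (t - ?x)) \<le> e * norm (t - ?x)"
      by blast
  qed
  then have "((\<lambda>t. f (X |\<^sub>m (r, c) \<mapsto> t)) has_real_derivative G $$ (r, c)) (at ?x)"
    by (simp add: has_field_derivative_def)
  \<comment> \<open>Uniqueness of derivatives identifies the entries of \<open>mat_grad\<close> with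
    those of the Frechet gradient \<open>G\<close>.\<close>
  moreover from this have "mat_grad f X $$ (r, c) = G $$ (r, c)"
    using X rc by (simp add: mat_grad_def DERIV_imp_deriv)
  ultimately show ?thesis by simp
qed

text \<open>Needed because \<open>f\<close> is known to be a composition only on \<open>U\<close>:
  derivatives in one entry can be transferred only if the perturbed matrix stays in \<open>U\<close>
  for nearby values.\<close>

lemma mat_open_eventually_update:
  assumes "mat_open n k U" "X \<in> U" "r < n" "c < k"
  shows "\<forall>\<^sub>F t in nhds (X $$ (r, c)). (X |\<^sub>m (r, c) \<mapsto> t) \<in> U"
proof -
  have X: "X \<in> carrier_mat n k"
    using assms unfolding mat_open_def by blast
  obtain e where "e > 0" and e: "\<And>Y. Y \<in> carrier_mat n k \<Longrightarrow> frob_norm (Y - X) < e \<Longrightarrow> Y \<in> U"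
    using assms unfolding mat_open_def by blast
  have "(X |\<^sub>m (r, c) \<mapsto> t) \<in> U" if "dist t (X $$ (r, c)) < e" for t
    using that X frob_norm_update_minus[OF X assms(3,4), of t]
    by (intro e) (auto simp: update_mat_def dist_real_def)
  with \<open>e > 0\<close> show ?thesis
    unfolding eventually_nhds_metric by blast
qed

section \<open>Column selection and its compatibility with entry updates\<close>

lemma bij_betw_pick:
  assumes "finite J"
  shows "bij_betw (pick J) {..<card J} J"
\<comment> \<open>The inverse sends a column index to its position in \<open>J\<close>, that is, to
  the number of smaller members of \<open>J\<close>; positions start at 0.\<close>
proof (rule bij_betw_byWitness[where f' = "\<lambda>c. card {a\<in>J. a < c}"])
  show "\<forall>p\<in>{..<card J}. card {a\<in>J. a < pick J p} = p"
    by (simp add: card_pick_le)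
  show "\<forall>c\<in>J. pick J (card {a\<in>J. a < c}) = c"
    by (simp add: pick_card_in_set)
  show "pick J ` {..<card J} \<subseteq> J"
    using pick_in_set_le by blast
  show "(\<lambda>c. card {a\<in>J. a < c}) ` J \<subseteq> {..<card J}"
    using assms by (auto intro!: psubset_card_mono)
qed

lemma col_submatrix_carrier:
  assumes "P \<in> carrier_mat n k" "J \<subseteq> {..<k}"
  shows "col_submatrix P J \<in> carrier_mat n (card J)"
proof -
  have "{j. j < k \<and> j \<in> J} = J" using assms(2) by auto
  then show ?thesis
    using assms(1) by (intro carrier_matI) (simp_all add: col_submatrix_def dim_submatrix)
qed

lemma col_submatrix_index:
  assumes "P \<in> carrier_mat n k" "J \<subseteq> {..<k}" "r < n" "p < card J"
  shows "col_submatrix P J $$ (r, p) = P $$ (r, pick J p)"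
proof -
  have "{j. j < k \<and> j \<in> J} = J" using assms(2) by auto
  then show ?thesis
    using assms by (simp add: col_submatrix_def submatrix_index pick_UNIV)
qed

text \<open>Distinct positions select distinct columns, so a change in column
  \<open>pick J p\<close> of \<open>P\<close> shows up in column \<open>p\<close> of the submatrix
  and in no other.\<close>

lemma col_submatrix_update:
  assumes P: "P \<in> carrier_mat n k" and J: "J \<subseteq> {..<k}" and rp: "r < n" "p < card J"
  shows "col_submatrix (P |\<^sub>m (r, pick J p) \<mapsto> t) J = (col_submatrix P J |\<^sub>m (r, p) \<mapsto> t)"
proof -
  have fin: "finite J" using J finite_subset by blast
  have P': "(P |\<^sub>m (r, pick J p) \<mapsto> t) \<in> carrier_mat n k"
    using P by (rule update_mat_carrier)
  note carr = col_submatrix_carrier[OF P J] col_submatrix_carrier[OF P' J]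
  have inj: "pick J q = pick J p \<longleftrightarrow> q = p" if "q < card J" for q
    using bij_betw_imp_inj_on[OF bij_betw_pick[OF fin]] that rp by (auto dest: inj_onD)
  have lt: "pick J q < k" if "q < card J" for q
    using pick_in_set_le[OF that] J by auto
  show ?thesis
    by (rule eq_matI)
      (use carr in \<open>auto simp: index_update_mat[OF carr(1)] index_update_mat[OF P] col_submatrix_index[OF P J]
          col_submatrix_index[OF P' J] lt inj simp del: index_update_mat1 index_update_mat2\<close>)
qed

lemma col_submatrix_update_other:
  assumes P: "P \<in> carrier_mat n k" and J: "J \<subseteq> {..<k}" and c: "c \<notin> J"
  shows "col_submatrix (P |\<^sub>m (r, c) \<mapsto> t) J = col_submatrix P J"
proof -
  have P': "(P |\<^sub>m (r, c) \<mapsto> t) \<in> carrier_mat n k"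
    using P by (rule update_mat_carrier)
  note carr = col_submatrix_carrier[OF P J] col_submatrix_carrier[OF P' J]
  have *: "pick J q < k \<and> pick J q \<noteq> c" if "q < card J" for q
    using pick_in_set_le[OF that] J c by auto
  show ?thesis
    by (rule eq_matI)
      (use carr * in \<open>auto simp: index_update_mat[OF P] col_submatrix_index[OF P J]
          col_submatrix_index[OF P' J] simp del: index_update_mat1 index_update_mat2\<close>)
qed

section \<open>First-order calculus for the outer function\<close>

lemma has_derivative_partial_deriv:
  fixes \<phi> :: "real ^ 'N::finite \<Rightarrow> real"
  assumes "\<phi> differentiable (at x)"
  shows "(\<phi> has_derivative (\<lambda>v. \<Sum>i\<in>UNIV. partial_deriv \<phi> i x * v $ i)) (at x)"
proof -
  obtain \<phi>' where \<phi>': "(\<phi> has_derivative \<phi>') (at x)"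
    using assms unfolding differentiable_def by blast
  then have lin: "linear \<phi>'"
    by (rule has_derivative_linear)
  \<comment> \<open>Composing with the line through \<open>x\<close> in direction
    \<open>axis i 1\<close> shows that the partial derivative is the value of the total derivative
    at that axis vector.\<close>
  have pd: "partial_deriv \<phi> i x = \<phi>' (axis i 1)" for i
  proof -
    have "((\<lambda>t::real. x + t *\<^sub>R axis i 1) has_derivative (\<lambda>t. t *\<^sub>R axis i 1)) (at 0)"
      by (auto intro!: derivative_eq_intros)
    from has_derivative_compose[OF this, of \<phi> \<phi>'] \<phi>'
    have "((\<lambda>t. \<phi> (x + t *\<^sub>R axis i 1)) has_derivative (\<lambda>t. \<phi>' (t *\<^sub>R axis i 1))) (at 0)"
      by simp
    moreover have "(\<lambda>t. \<phi>' (t *\<^sub>R axis i 1)) = (\<lambda>t. \<phi>' (axis i 1) * t)"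
      using linear_cmul[OF lin] by auto
    ultimately show ?thesis
      unfolding partial_deriv_def by (intro DERIV_imp_deriv) (simp add: has_field_derivative_def)
  qed
  \<comment> \<open>A linear functional is determined by its values on the coordinate axes.\<close>
  have expand: "\<phi>' v = (\<Sum>i\<in>UNIV. \<phi>' (axis i 1) * v $ i)" for v
  proof -
    have "\<phi>' v = \<phi>' (\<Sum>i\<in>UNIV. v $ i *\<^sub>R axis i 1)"
      using basis_expansion[of v] by (simp add: scalar_mult_eq_scaleR)
    also have "\<dots> = (\<Sum>i\<in>UNIV. \<phi>' (axis i 1) * v $ i)"
      by (simp add: linear_sum[OF lin] linear_cmul[OF lin] mult.commute)
    finally show ?thesis .
  qed
  have "\<phi>' = (\<lambda>v. \<Sum>i\<in>UNIV. partial_deriv \<phi> i x * v $ i)"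
    by (rule ext, subst expand) (simp only: pd)
  with \<phi>' show ?thesis by blast
qed

text \<open>On the segment from \<open>x\<close> to \<open>y\<close>, convexity bounds every
  difference quotient with step in (0,1) by \<open>\<phi> y - \<phi> x\<close>; the directional
  derivative is their limit as the step tends to 0.\<close>

lemma convex_on_gradient_inequality:
  fixes \<phi> :: "'a::real_normed_vector \<Rightarrow> real"
  assumes "convex_on D \<phi>" "x \<in> D" "y \<in> D" "(\<phi> has_derivative \<phi>') (at x)"
  shows "\<phi>' (y - x) \<le> \<phi> y - \<phi> x"
proof -
  let ?g = "\<lambda>t::real. \<phi> (x + t *\<^sub>R (y - x))"
  have lin: "linear \<phi>'"
    using assms(4) by (rule has_derivative_linear)
  have "((\<lambda>t::real. x + t *\<^sub>R (y - x)) has_derivative (\<lambda>t. t *\<^sub>R (y - x))) (at 0)"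
    by (auto intro!: derivative_eq_intros)
  from has_derivative_compose[OF this, of \<phi> \<phi>'] assms(4)
  have "(?g has_derivative (\<lambda>t. \<phi>' (t *\<^sub>R (y - x)))) (at 0)"
    by simp
  moreover have "(\<lambda>t. \<phi>' (t *\<^sub>R (y - x))) = (\<lambda>t. \<phi>' (y - x) * t)"
    using linear_cmul[OF lin] by auto
  ultimately have "(?g has_real_derivative \<phi>' (y - x)) (at 0)"
    by (simp add: has_field_derivative_def)
  \<comment> \<open>Only positive steps stay on the segment, so the limit is taken from the
    right.\<close>
  then have "((\<lambda>t. (?g t - ?g 0) / t) \<longlongrightarrow> \<phi>' (y - x)) (at_right 0)"
    by (auto simp: has_field_derivative_iff intro: filterlim_mono[OF _ order_refl at_le])
  moreover have "\<forall>\<^sub>F t in at_right 0. (?g t - ?g 0) / t \<le> \<phi> y - \<phi> x"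
  proof -
    have "(?g t - ?g 0) / t \<le> \<phi> y - \<phi> x" if t: "0 < t" "t < 1" for t :: real
    proof -
      have "x + t *\<^sub>R (y - x) = (1 - t) *\<^sub>R x + t *\<^sub>R y"
        by (simp add: algebra_simps)
      then have "?g t \<le> (1 - t) * \<phi> x + t * \<phi> y"
        using convex_onD[OF assms(1), of t x y] t assms(2,3) by simp
      then show ?thesis
        using t by (simp add: field_simps)
    qed
    then show ?thesis
      unfolding eventually_at_right_field by (intro exI[of _ 1]) auto
  qed
  ultimately show ?thesis
    by (intro tendsto_upperbound) auto
qed

section \<open>Chain rule for the composed objective\<close>

text \<open>This is the formula for H(P) read entrywise. Right multiplication of the i-th gradient
  by the transposed column selector moves the column at position
  \<open>card {a\<in>J i. a < c}\<close> to column \<open>c\<close> and fills the columns outside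
  \<open>J i\<close> with zeros, hence the conditional.\<close>

lemma mat_grad_comp_stack:
  fixes \<phi> :: "real ^ 'N::finite \<Rightarrow> real"
  assumes U: "mat_open n k U" and f: "\<And>P. P \<in> U \<Longrightarrow> f P = \<phi> (stack fs J P)"
    and P: "P \<in> U" and J: "\<And>i. J i \<subseteq> {..<k}"
    and \<phi>: "\<phi> differentiable (at (stack fs J P))"
    and fs: "\<And>i. mat_differentiable (fs i) (col_submatrix P (J i))"
    and rc: "r < n" "c < k"
  shows "mat_grad f P $$ (r, c) = (\<Sum>i\<in>UNIV. partial_deriv \<phi> i (stack fs J P) *
    (if c \<in> J i then mat_grad (fs i) (col_submatrix P (J i)) $$ (r, card {a\<in>J i. a < c}) else 0))"
    (is "_ = (\<Sum>i\<in>UNIV. ?d i * ?g i)")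
proof -
  have carr: "P \<in> carrier_mat n k"
    using U P unfolding mat_open_def by blast
  let ?x = "P $$ (r, c)"
  let ?P = "\<lambda>t. P |\<^sub>m (r, c) \<mapsto> t"
  \<comment> \<open>If \<open>c\<close> is in \<open>J i\<close>, exactly one entry of the i-th
    submatrix moves and the derivative is a partial derivative of \<open>fs i\<close>; otherwise the
    submatrix is constant in \<open>t\<close>.\<close>
  have "((\<lambda>t. fs i (col_submatrix (?P t) (J i))) has_real_derivative ?g i) (at ?x)" for i
  proof (cases "c \<in> J i")
    case True
    let ?p = "card {a\<in>J i. a < c}"
    have fin: "finite (J i)" using J finite_subset by blast
    have p: "pick (J i) ?p = c" using True by (rule pick_card_in_set)
    have lt: "?p < card (J i)"
      using fin True by (auto intro!: psubset_card_mono)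
    show ?thesis
      using mat_differentiable_has_real_derivative[OF fs col_submatrix_carrier[OF carr J] rc(1) lt]
        col_submatrix_update[OF carr J rc(1) lt] col_submatrix_index[OF carr J rc(1) lt] True
      by (simp add: p)
  next
    case False
    then show ?thesis by (simp add: col_submatrix_update_other[OF carr J])
  qed
  then have "((\<lambda>t. stack fs J (?P t)) has_derivative (\<lambda>h. \<chi> i. ?g i * h)) (at ?x)"
    by (subst has_derivative_componentwise_within)
      (auto simp: stack_def Basis_vec_def inner_axis has_field_derivative_def)
  from has_derivative_compose[OF this, of \<phi>, unfolded update_mat_self, OF has_derivative_partial_deriv[OF \<phi>]]
  have "((\<lambda>t. \<phi> (stack fs J (?P t))) has_derivative (\<lambda>h. \<Sum>i\<in>UNIV. ?d i * (?g i * h))) (at ?x)"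
    by (simp cong del: if_cong)
  moreover have "(\<lambda>h. \<Sum>i\<in>UNIV. ?d i * (?g i * h)) = (*) (\<Sum>i\<in>UNIV. ?d i * ?g i)"
    by (rule ext) (simp only: sum_distrib_right mult.assoc)
  ultimately have "((\<lambda>t. \<phi> (stack fs J (?P t))) has_real_derivative (\<Sum>i\<in>UNIV. ?d i * ?g i)) (at ?x)"
    unfolding has_field_derivative_def by (simp only:)
  \<comment> \<open>Derivatives depend only on values near the point, so agreement of
    \<open>f\<close> with the composition near \<open>?x\<close> suffices.\<close>
  moreover have "\<forall>\<^sub>F t in nhds ?x. f (?P t) = \<phi> (stack fs J (?P t))"
    using mat_open_eventually_update[OF U P rc] by (rule eventually_mono) (rule f)
  ultimately have "((\<lambda>t. f (?P t)) has_real_derivative (\<Sum>i\<in>UNIV. ?d i * ?g i)) (at ?x)"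
    by (simp only: DERIV_cong_ev[OF refl _ refl])
  then show ?thesis
    using carr rc by (simp add: mat_grad_def[of f P] DERIV_imp_deriv)
qed

text \<open>The matrix \<open>Z\<close> is arbitrary so that the formula serves both traces in the
  ansatz, with \<open>Z\<close> taken as \<open>P\<close> and as \<open>P'\<close>.\<close>

lemma mtrace_mat_grad_comp_stack:
  fixes \<phi> :: "real ^ 'N::finite \<Rightarrow> real"
  assumes U: "mat_open n k U" and f: "\<And>P. P \<in> U \<Longrightarrow> f P = \<phi> (stack fs J P)"
    and P: "P \<in> U" and J: "\<And>i. J i \<subseteq> {..<k}"
    and \<phi>: "\<phi> differentiable (at (stack fs J P))"
    and fs: "\<And>i. mat_differentiable (fs i) (col_submatrix P (J i))"
    and Z: "Z \<in> carrier_mat n k"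
  shows "mtrace (transpose_mat Z * mat_grad f P) = (\<Sum>i\<in>UNIV. partial_deriv \<phi> i (stack fs J P) *
    mtrace (transpose_mat (col_submatrix Z (J i)) * mat_grad (fs i) (col_submatrix P (J i))))"
proof -
  have carr: "P \<in> carrier_mat n k"
    using U P unfolding mat_open_def by blast
  let ?d = "\<lambda>i. partial_deriv \<phi> i (stack fs J P)"
  let ?G = "\<lambda>i. mat_grad (fs i) (col_submatrix P (J i))"
  let ?g = "\<lambda>i r c. if c \<in> J i then ?G i $$ (r, card {a\<in>J i. a < c}) else 0"
  have entry: "(\<Sum>c<k. \<Sum>r<n. Z $$ (r, c) * ?g i r c) = mtrace (transpose_mat (col_submatrix Z (J i)) * ?G i)" for i
  proof -
    have fin: "finite (J i)" using J finite_subset by blast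
    \<comment> \<open>Columns outside \<open>J i\<close> contribute zero; the remaining ones are
      then renumbered by position through \<open>pick\<close>, which turns the counting index back
      into \<open>p\<close>.\<close>
    have "(\<Sum>c<k. \<Sum>r<n. Z $$ (r, c) * ?g i r c)
        = (\<Sum>c\<in>J i. \<Sum>r<n. Z $$ (r, c) * ?G i $$ (r, card {a\<in>J i. a < c}))"
      using J by (intro sum.mono_neutral_cong_right) auto
    also have "\<dots> = (\<Sum>p<card (J i). \<Sum>r<n. Z $$ (r, pick (J i) p) * ?G i $$ (r, p))"
      by (subst sum.reindex_bij_betw[OF bij_betw_pick[OF fin], symmetric]) (simp add: card_pick_le)
    also have "\<dots> = mtrace (transpose_mat (col_submatrix Z (J i)) * ?G i)"
      by (simp add: mtrace_transpose_mult[OF col_submatrix_carrier[OF Z J] mat_grad_carrier[OF col_submatrix_carrier[OF carr J]]]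
          col_submatrix_index[OF Z J])
    finally show ?thesis .
  qed
  have "mtrace (transpose_mat Z * mat_grad f P) = (\<Sum>c<k. \<Sum>r<n. Z $$ (r, c) * mat_grad f P $$ (r, c))"
    by (rule mtrace_transpose_mult[OF Z mat_grad_carrier[OF carr]])
  also have "\<dots> = (\<Sum>c<k. \<Sum>r<n. \<Sum>i\<in>UNIV. ?d i * (Z $$ (r, c) * ?g i r c))"
    using mat_grad_comp_stack[OF U f P J \<phi> fs]
    by (intro sum.cong refl) (simp add: sum_distrib_left mult.left_commute cong del: if_cong)
  also have "\<dots> = (\<Sum>c<k. \<Sum>i\<in>UNIV. \<Sum>r<n. ?d i * (Z $$ (r, c) * ?g i r c))"
    by (intro sum.cong refl sum.swap)
  also have "\<dots> = (\<Sum>i\<in>UNIV. \<Sum>c<k. \<Sum>r<n. ?d i * (Z $$ (r, c) * ?g i r c))"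
    by (rule sum.swap)
  also have "\<dots> = (\<Sum>i\<in>UNIV. ?d i * (\<Sum>c<k. \<Sum>r<n. Z $$ (r, c) * ?g i r c))"
    by (simp only: sum_distrib_left)
  finally show ?thesis by (simp only: entry)
qed

section \<open>The NPDo ansatz for the convex composition\<close>

text \<open>The function \<open>Q\<close> is a choice of the matrix in (B). It depends on
  \<open>P\<close> and \<open>P'\<close> but not on \<open>i\<close>, and it lets
  \<open>nonneg\<close> speak of equality for the very same matrix. The open set \<open>U\<close> is
  the neighborhood in which single entries can vary, since such variations generally leave the
  Stiefel manifold.\<close>

theorem theorem5p1:
  fixes k n :: nat
    and f :: "real mat \<Rightarrow> real"
    and \<phi> :: "real ^ 'N \<Rightarrow> real"
    and D :: "(real ^ 'N) set"
    and fs :: "'N::finite \<Rightarrow> real mat \<Rightarrow> real"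
    and J :: "'N \<Rightarrow> nat set"
    and U \<P> :: "real mat set"
    and \<alpha> :: real
    and \<beta> \<gamma> :: "'N \<Rightarrow> real"
    and Q :: "real mat \<Rightarrow> real mat \<Rightarrow> real mat"
  assumes "1 \<le> k" and "k \<le> n"
    and "\<And>i. J i \<noteq> {}" and "\<And>i. J i \<subseteq> {..<k}"
    and "mat_open n k U" and "stiefel k n \<subseteq> U"
    and "\<And>P. P \<in> U \<Longrightarrow> stack fs J P \<in> D"
    and "\<And>P. P \<in> U \<Longrightarrow> f P = \<phi> (stack fs J P)"
    and "\<And>P. P \<in> U \<Longrightarrow> mat_differentiable f P"
    and "\<And>i P. P \<in> U \<Longrightarrow> mat_differentiable (fs i) (col_submatrix P (J i))"
    and "convex D" and "convex_on D \<phi>"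
    and "\<And>x. x \<in> D \<Longrightarrow> \<phi> differentiable (at x)"
    and "\<P> \<subseteq> stiefel k n"
    and "\<alpha> > 0" and "\<And>i. \<beta> i \<ge> 0" and "\<And>i. \<gamma> i = \<alpha> + \<beta> i"
    and A: "\<And>i P. P \<in> \<P> \<Longrightarrow>
          mtrace (transpose_mat (col_submatrix P (J i)) * mat_grad (fs i) (col_submatrix P (J i)))
            = \<gamma> i * fs i (col_submatrix P (J i))"
    and B_Q: "\<And>P P'. P \<in> \<P> \<Longrightarrow> P' \<in> stiefel k n \<Longrightarrow>
          Q P P' \<in> stiefel k k \<and> P' * Q P P' \<in> \<P>"
    and B_le: "\<And>i P P'. P \<in> \<P> \<Longrightarrow> P' \<in> stiefel k n \<Longrightarrow>
          mtrace (transpose_mat (col_submatrix P' (J i)) * mat_grad (fs i) (col_submatrix P (J i)))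
            \<le> \<alpha> * fs i (col_submatrix (P' * Q P P') (J i)) + \<beta> i * fs i (col_submatrix P (J i))"
    and nonneg: "\<And>i.
          \<not> (\<forall>P\<in>\<P>. \<forall>P'\<in>stiefel k n.
                mtrace (transpose_mat (col_submatrix P' (J i)) * mat_grad (fs i) (col_submatrix P (J i)))
                  = \<alpha> * fs i (col_submatrix (P' * Q P P') (J i)) + \<beta> i * fs i (col_submatrix P (J i)))
          \<Longrightarrow> \<forall>x\<in>D. partial_deriv \<phi> i x \<ge> 0"
  shows "NPDo_ansatz k n f \<P> (1 / \<alpha>)"
proof -
  note J = assms(4) and U = assms(5) and StU = assms(6) and TD = assms(7) and f = assms(8)
    and fs = assms(10) and cvx = assms(12) and diff = assms(13) and PSt = assms(14)
    and \<alpha> = assms(15) and \<gamma> = assms(17)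
  have "P' * Q P P' \<in> \<P> \<and> f (P' * Q P P') \<ge> f P + 1 / \<alpha> * \<eta>"
    if P: "P \<in> \<P>" and P': "P' \<in> stiefel k n"
      and \<eta>: "mtrace (transpose_mat P' * mat_grad f P) \<ge> mtrace (transpose_mat P * mat_grad f P) + \<eta>"
    for P P' \<eta>
  proof
    let ?R = "P' * Q P P'"
    let ?x = "stack fs J P" and ?y = "stack fs J ?R"
    let ?d = "\<lambda>i. partial_deriv \<phi> i ?x"
    let ?tr = "\<lambda>Z i. mtrace (transpose_mat (col_submatrix Z (J i)) * mat_grad (fs i) (col_submatrix P (J i)))"
    show R: "?R \<in> \<P>" using B_Q[OF P P'] by blast
    have PU: "P \<in> U" and RU: "?R \<in> U" using P R PSt StU by auto
    then have x: "?x \<in> D" and y: "?y \<in> D" using TD by auto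
    have tr: "mtrace (transpose_mat Z * mat_grad f P) = (\<Sum>i\<in>UNIV. ?d i * ?tr Z i)"
      if "Z \<in> stiefel k n" for Z
      using that mtrace_mat_grad_comp_stack[OF U f PU J diff[OF x] fs[OF PU], of Z]
      by (simp add: stiefel_def)
    have *: "?d i * ?tr P' i \<le> ?d i * (\<alpha> * ?y $ i + \<beta> i * ?x $ i)" for i
    \<comment> \<open>Equality at this one pair settles the claim whatever the sign of the weight.
      Strictness at this pair already refutes equality for the index \<open>i\<close>, so
      \<open>nonneg\<close> gives a nonnegative weight.\<close>
    proof (cases "?tr P' i = \<alpha> * ?y $ i + \<beta> i * ?x $ i")
      case False
      then have "?d i \<ge> 0"
        using nonneg[of i] P P' x by (auto simp: stack_def)
      then show ?thesis
        using B_le[OF P P', of i] by (auto simp: stack_def intro: mult_left_mono)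
    qed simp
    have "\<eta> \<le> (\<Sum>i\<in>UNIV. ?d i * ?tr P' i) - (\<Sum>i\<in>UNIV. ?d i * ?tr P i)"
      using \<eta> tr[OF P'] tr[of P] P PSt by auto
    also have "\<dots> \<le> (\<Sum>i\<in>UNIV. ?d i * (\<alpha> * ?y $ i + \<beta> i * ?x $ i)) - (\<Sum>i\<in>UNIV. ?d i * (\<gamma> i * ?x $ i))"
      using sum_mono[of UNIV, OF *] A[OF P] by (simp add: stack_def)
    \<comment> \<open>Since \<open>\<gamma> i = \<alpha> + \<beta> i\<close>, the terms with
      \<open>\<beta> i\<close> cancel, and one common factor \<open>\<alpha>\<close> remains for all
      \<open>i\<close>; it is the source of the constant \<open>1 / \<alpha>\<close>.\<close>
    also have "\<dots> = \<alpha> * (\<Sum>i\<in>UNIV. ?d i * (?y - ?x) $ i)"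
      by (simp add: \<gamma> sum_distrib_left algebra_simps flip: sum_subtractf)
    also have "\<dots> \<le> \<alpha> * (\<phi> ?y - \<phi> ?x)"
      using convex_on_gradient_inequality[OF cvx x y has_derivative_partial_deriv[OF diff[OF x]]] \<alpha>
      by (intro mult_left_mono) auto
    finally show "f ?R \<ge> f P + 1 / \<alpha> * \<eta>"
      using \<alpha> f[OF PU] f[OF RU] by (simp add: field_simps)
  qed
  then show ?thesis
    unfolding NPDo_ansatz_def
    using \<alpha> B_Q by (intro conjI ballI allI impI bexI[of _ "Q _ _"]) auto
qed

end
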